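(* Let $f:\mathbb{Z}^n\to\mathbb{R}\cup\{+\infty\}$ be a DDM-convex function. Let $x,y\in\operatorname{dom} f$, let $m=\|y-x\|_\infty$, and for $k=1,\dots,m$ let $A_k=\{i\mid y_i-x_i\ge k\}$ and $B_k=\{i\mid y_i-x_i\le -k\}$. For any subset $J\subseteq\{1,\dots,m\}$, let $d=\sum_{k\in J}(\mathbf{1}_{A_k}-\mathbf{1}_{B_k})$. Then $$f(x)+f(y)\ge f(x+d)+f(y-d).$$
   Context: $\operatorname{dom} f=\{x\in\mathbb{Z}^n\mid f(x)<+\infty\}$. For $A\subseteq\{1,\dots,n\}$, $\mathbf{1}_A\in\{0,1\}^n$ is the characteristic vector of $A$. For $x,y\in\mathbb{Z}^n$, the vector $\mu(x,y)\in\mathbb{Z}^n$ is defined componentwise by $\mu(x,y)_i=\lceil (x_i+y_i)/2\rceil$ if $x_i\ge y_i$, and $\mu(x,y)_i=\lfloor (x_i+y_i)/2\rfloor$ if $x_i<y_i$. A function $f:\mathbb{Z}^n\to\mathbb{R}\cup\{+\infty\}$ is called DDM-convex if $f(x)+f(y)\ge f(\mu(x,y))+f(\mu(y,x))$ for all $x,y\in\mathbb{Z}^n$. *)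

theory Defs
  imports "HOL-Analysis.Analysis"
begin

text \<open>
  Points of \<open>\<int>\<^sup>n\<close> are elements of \<open>int ^ 'n\<close>, and functions into
  \<open>\<real> \<union> {+\<infinity>}\<close> are \<open>ereal\<close>-valued functions that never take the value \<open>-\<infinity>\<close>.
\<close>

definition eff_dom :: "(int ^ 'n \<Rightarrow> ereal) \<Rightarrow> (int ^ 'n) set" where
  "eff_dom f = {x. f x < \<infinity>}"

definition char_vec :: "'n set \<Rightarrow> int ^ 'n" where
  "char_vec A = (\<chi> i. indicator A i)"

definition linf_norm :: "int ^ 'n \<Rightarrow> int" where
  "linf_norm z = Max (range (\<lambda>i. \<bar>z $ i\<bar>))"

definition ddm_mu :: "int ^ 'n \<Rightarrow> int ^ 'n \<Rightarrow> int ^ 'n" where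
  "ddm_mu x y = (\<chi> i. if x $ i \<ge> y $ i
                       then \<lceil>real_of_int (x $ i + y $ i) / 2\<rceil>
                       else \<lfloor>real_of_int (x $ i + y $ i) / 2\<rfloor>)"

definition DDM_convex :: "(int ^ 'n \<Rightarrow> ereal) \<Rightarrow> bool" where
  "DDM_convex f \<longleftrightarrow>
     (\<forall>z. f z \<noteq> -\<infinity>) \<and>
     (\<forall>x y. f x + f y \<ge> f (ddm_mu x y) + f (ddm_mu y x))"

end

theory Submission
  imports Defs
begin

text \<open>
  Write \<open>y - x = e\<^sub>1 + \<dots> + e\<^sub>m\<close> with the layers \<open>e\<^sub>k = 1\<^bsub>A\<^sub>k\<^esub> - 1\<^bsub>B\<^sub>k\<^esub>\<close>, and put
  \<open>F S = f (x + (\<Sum>k\<in>S. e\<^sub>k))\<close> for \<open>S \<subseteq> {1..m}\<close>.  The claim becomes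
  \<open>F {} + F {1..m} \<ge> F J + F ({1..m} - J)\<close>, an instance of supermodularity of \<open>F\<close>.

  The layers are nested: the coordinate \<open>i\<close> of \<open>e\<^sub>k\<close> is nonzero exactly for \<open>k \<le> \<bar>y\<^sub>i - x\<^sub>i\<bar>\<close>, and
  then it is the sign of \<open>y\<^sub>i - x\<^sub>i\<close>.  So if \<open>S \<subseteq> T\<close>, the coordinate \<open>i\<close> sees only an initial segment of \<open>T - S\<close>, and
  taking every other element of \<open>T - S\<close>, starting with the least one, takes half of that segment,
  rounded up.  Hence the two directed midpoints of the points that belong to \<open>S\<close> and \<open>T\<close> belong to
  \<open>S \<union> O\<close> and \<open>T - O\<close>, where \<open>O\<close> consists of the elements of odd rank in \<open>T - S\<close>, and DDM-convexity
  reads \<open>F S + F T \<ge> F (S \<union> O) + F (T - O)\<close> (\<open>DDM_convex_layers\<close>).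

  If \<open>T - S\<close> has two elements, this is supermodularity on a square of the Boolean lattice.  For
  real-valued functions the squares imply the general case (\<open>supermodular_if_local\<close>), so it remains
  to see that \<open>F\<close> is finite everywhere.  This follows from finiteness at \<open>{}\<close> and \<open>{1..m}\<close> by
  induction on the length of intervals (\<open>between_closed_under_halving\<close>): halving \<open>[S, T]\<close> gives two
  shorter intervals above \<open>S\<close> that reach every \<open>S \<union> {a}\<close>, and \<open>[S \<union> {a}, T]\<close> is shorter, too.
\<close>

section \<open>Elements of odd rank\<close>

definition odd_rank :: "'a::linorder set \<Rightarrow> 'a set" where
  "odd_rank D = {k \<in> D. odd (card {j \<in> D. j \<le> k})}"

lemma odd_rank_subset: "odd_rank D \<subseteq> D"
  by (auto simp: odd_rank_def)

lemma odd_rank_initial_segment: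
  "odd_rank {k \<in> D. k \<le> s} = {k \<in> odd_rank D. k \<le> s}"
proof -
  have "{j. j \<in> D \<and> j \<le> s \<and> j \<le> k} = {j \<in> D. j \<le> k}" if "k \<le> s" for k
    using that by auto
  then show ?thesis
    by (auto simp: odd_rank_def)
qed

lemma odd_rank_insert_greatest:
  assumes "finite D" and "\<And>a. a \<in> D \<Longrightarrow> a < b"
  shows "odd_rank (insert b D) = (if even (card D) then insert b (odd_rank D) else odd_rank D)"
proof -
  have b: "b \<notin> D" using assms(2) by blast
  have "{j \<in> insert b D. j \<le> b} = insert b D"
    using assms(2) by (auto intro: less_imp_le)
  moreover have "{j \<in> insert b D. j \<le> k} = {j \<in> D. j \<le> k}" if "k \<in> D" for k
    using assms(2)[OF that] by auto
  ultimately show ?thesis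
    using b assms(1) by (auto simp: odd_rank_def)
qed

lemma card_odd_rank:
  "finite D \<Longrightarrow> card (odd_rank D) = (card D + 1) div 2"
proof (induction D rule: finite_linorder_max_induct)
  case empty
  then show ?case by (simp add: odd_rank_def)
next
  case (insert b D)
  have b: "b \<notin> D" using insert.hyps by blast
  then have "b \<notin> odd_rank D" using odd_rank_subset by blast
  moreover have "finite (odd_rank D)"
    using insert.hyps(1) odd_rank_subset finite_subset by blast
  ultimately show ?case
    using insert b by (auto simp: odd_rank_insert_greatest elim: oddE evenE)
qed

section \<open>Set functions that are convex under halving\<close>

text \<open>
  \<open>P\<close> stands for membership in the effective domain of the set function.  Halving reaches the singletons above
  \<open>S\<close>, and every set above \<open>S\<close> other than \<open>S\<close> lies above one of them; this settles the interval,
  since all the intervals involved are shorter than \<open>[S, T]\<close>.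
\<close>
lemma between_closed_under_halving:
  fixes P :: "'a::linorder set \<Rightarrow> bool"
  assumes "finite T" "S \<subseteq> J" "J \<subseteq> T" "P S" "P T"
    and halving: "\<And>S' T'. S \<subseteq> S' \<Longrightarrow> S' \<subseteq> T' \<Longrightarrow> T' \<subseteq> T \<Longrightarrow> P S' \<Longrightarrow> P T' \<Longrightarrow>
          P (S' \<union> odd_rank (T' - S')) \<and> P (T' - odd_rank (T' - S'))"
  shows "P J"
  using assms
proof (induction "card (T - S)" arbitrary: S T J rule: less_induct)
  case less
  note fin = \<open>finite T\<close>
  show ?case
  proof (cases "J = S")
    case True
    then show ?thesis using less.prems by simp
  next
    case False
    then obtain a where a: "a \<in> J" "a \<notin> S" using less.prems by blast
    have shorter: "P K"
      if "S \<subseteq> S'" "S' \<subseteq> K" "K \<subseteq> T'" "T' \<subseteq> T" "S \<noteq> S' \<or> T' \<noteq> T" "P S'" "P T'" for S' K T'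
    proof -
      have "T' - S' \<subset> T - S" using that less.prems(2,3) by blast
      then have "card (T' - S') < card (T - S)"
        using fin by (intro psubset_card_mono) auto
      moreover have "finite T'" using that(4) fin finite_subset by blast
      moreover have "P (S'' \<union> odd_rank (T'' - S'')) \<and> P (T'' - odd_rank (T'' - S''))"
        if "S' \<subseteq> S''" "S'' \<subseteq> T''" "T'' \<subseteq> T'" "P S''" "P T''" for S'' T''
        using less.prems(6)[of S'' T''] that \<open>S \<subseteq> S'\<close> \<open>T' \<subseteq> T\<close> by (meson order_trans)
      ultimately show ?thesis
        using less.hyps[of T' S' K] that by presburger
    qed
    have "P (insert a S)"
    proof (cases "T = insert a S")
      case True
      then show ?thesis using less.prems by simp
    next
      case False
      define O' where "O' = odd_rank (T - S)"
      have sub: "O' \<subseteq> T - S" by (simp add: O'_def odd_rank_subset)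
      \<comment> \<open>Halving is useful only from two elements on, where both halves are nonempty.\<close>
      have aT: "a \<in> T" using a less.prems by blast
      then have "{a} \<subset> T - S" using a False less.prems by blast
      then have "card {a} < card (T - S)"
        using fin by (intro psubset_card_mono) auto
      then have "0 < card O'" "card O' < card (T - S)"
        using fin by (auto simp: O'_def card_odd_rank)
      then have proper: "O' \<noteq> {}" "O' \<noteq> T - S" by auto
      have "P (S \<union> O')" "P (T - O')"
        using less.prems(6)[of S T] less.prems by (auto simp: O'_def)
      show ?thesis
      proof (cases "a \<in> O'")
        case True
        then show ?thesis
          using \<open>P (S \<union> O')\<close> sub proper \<open>P S\<close> \<open>S \<subseteq> J\<close> \<open>J \<subseteq> T\<close>
          by (intro shorter[of S "insert a S" "S \<union> O'"]) auto
      next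
        case False
        then show ?thesis
          using \<open>P (T - O')\<close> sub proper \<open>P S\<close> \<open>S \<subseteq> J\<close> \<open>J \<subseteq> T\<close> aT
          by (intro shorter[of S "insert a S" "T - O'"]) auto
      qed
    qed
    then show ?thesis
      using a less.prems(2,3,5) by (intro shorter[of "insert a S" J T]) auto
  qed
qed

text \<open>
  The inequality on squares says that the increment from adding \<open>a\<close> grows when one further element
  is adjoined.  Iterating gives its monotonicity in the base set, and telescoping over the elements
  of \<open>A\<close> the monotonicity of the increment from adding \<open>A\<close>.
\<close>
lemma supermodular_if_local:
  fixes G :: "'a set \<Rightarrow> real"
  assumes "finite U"
    and local: "\<And>S a b. S \<subseteq> U \<Longrightarrow> a \<in> U - S \<Longrightarrow> b \<in> U - S \<Longrightarrow> a \<noteq> b \<Longrightarrow>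
          G (insert a S) + G (insert b S) \<le> G S + G (insert a (insert b S))"
    and "A \<union> B \<subseteq> U" and "A \<inter> B = {}"
  shows "G A + G B \<le> G {} + G (A \<union> B)"
proof -
  have fin: "finite A" "finite B" using assms finite_subset by blast+
  have incr: "G (insert a S) - G S \<le> G (insert a (S \<union> C)) - G (S \<union> C)"
    if "finite C" "S \<union> C \<subseteq> U" "a \<in> U - (S \<union> C)" for a S C
    using that
  proof (induction C rule: finite_induct)
    case empty
    then show ?case by simp
  next
    case (insert b C)
    show ?case
    proof (cases "b \<in> S")
      case True
      then have "S \<union> insert b C = S \<union> C" by blast
      then show ?thesis using insert by simp
    next
      case False
      have "G (insert a (S \<union> C)) + G (insert b (S \<union> C))
          \<le> G (S \<union> C) + G (insert a (insert b (S \<union> C)))"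
        using insert False by (intro local) auto
      moreover have "G (insert a S) - G S \<le> G (insert a (S \<union> C)) - G (S \<union> C)"
        using insert by auto
      ultimately show ?thesis by simp
    qed
  qed
  show ?thesis using fin(1) assms(3,4)
  proof (induction A rule: finite_induct)
    case empty
    then show ?case by simp
  next
    case (insert a A)
    have "G (insert a A) - G A \<le> G (insert a (A \<union> B)) - G (A \<union> B)"
      using insert fin(2) by (intro incr) auto
    moreover have "G A + G B \<le> G {} + G (A \<union> B)"
      using insert by auto
    ultimately show ?case by simp
  qed
qed

lemma parallelogram_if_halving:
  fixes F :: "'a::linorder set \<Rightarrow> ereal"
  assumes "finite U" and "J \<subseteq> U"
    and ninf: "\<And>S. F S \<noteq> -\<infinity>"
    and ends: "F {} < \<infinity>" "F U < \<infinity>"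
    and halving: "\<And>S T. S \<subseteq> T \<Longrightarrow> T \<subseteq> U \<Longrightarrow>
          F (S \<union> odd_rank (T - S)) + F (T - odd_rank (T - S)) \<le> F S + F T"
  shows "F J + F (U - J) \<le> F {} + F U"
proof -
  have finite_values: "F S < \<infinity>" if "S \<subseteq> U" for S
  proof (rule between_closed_under_halving[where P = "\<lambda>S. F S < \<infinity>" and S = "{}" and T = U])
    fix S T assume "S \<subseteq> T" "T \<subseteq> U" "F S < \<infinity>" "F T < \<infinity>"
    then have "F (S \<union> odd_rank (T - S)) + F (T - odd_rank (T - S)) < \<infinity>"
      using halving[of S T] by (auto intro: le_less_trans)
    then show "F (S \<union> odd_rank (T - S)) < \<infinity> \<and> F (T - odd_rank (T - S)) < \<infinity>"
      by (auto simp: ninf)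
  qed (use assms that in auto)
  define G where "G S = real_of_ereal (F S)" for S
  have F: "F S = ereal (G S)" if "S \<subseteq> U" for S
    using finite_values[OF that] ninf[of S] by (cases "F S") (auto simp: G_def)
  have square: "G (insert a S) + G (insert b S) \<le> G S + G (insert a (insert b S))"
    if "S \<subseteq> U" "a \<in> U - S" "b \<in> U - S" "a < b" for S a b
  proof -
    define T where "T = insert a (insert b S)"
    have "T - S = insert b {a}" using that by (auto simp: T_def)
    moreover have "odd_rank {a} = {a}"
      using odd_rank_insert_greatest[of "{}" a] by (simp add: odd_rank_def)
    ultimately have "odd_rank (T - S) = {a}"
      using that(4) by (subst \<open>T - S = _\<close>, subst odd_rank_insert_greatest) auto
    moreover have "T - {a} = insert b S" using that by (auto simp: T_def)
    ultimately have "F (insert a S) + F (insert b S) \<le> F S + F T"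
      using halving[of S T] that by (auto simp: T_def)
    then show ?thesis using that by (simp add: F T_def)
  qed
  have "G J + G (U - J) \<le> G {} + G (J \<union> (U - J))"
  proof (rule supermodular_if_local)
    fix S a b assume *: "S \<subseteq> U" "a \<in> U - S" "b \<in> U - S" "a \<noteq> b"
    then consider "a < b" | "b < a" by (meson neqE)
    then show "G (insert a S) + G (insert b S) \<le> G S + G (insert a (insert b S))"
      using square[of S a b] square[of S b a] * by cases (auto simp: insert_commute add.commute)
  qed (use assms in auto)
  moreover have "J \<union> (U - J) = U" using assms(2) by blast
  ultimately show ?thesis using assms(2) by (simp add: F)
qed

section \<open>Layers of an integer vector\<close>

definition layer :: "int ^ 'n \<Rightarrow> int \<Rightarrow> int ^ 'n" where
  "layer z k = char_vec {i. z $ i \<ge> k} - char_vec {i. z $ i \<le> - k}"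

lemma sum_layer_nth:
  assumes "S \<subseteq> {1..m}"
  shows "(\<Sum>k\<in>S. layer z k) $ i = sgn (z $ i) * int (card {k \<in> S. k \<le> \<bar>z $ i\<bar>})"
proof -
  have fin: "finite S" using assms finite_subset by blast
  have "layer z k $ i = sgn (z $ i) * (if k \<le> \<bar>z $ i\<bar> then 1 else 0)" if "k \<in> S" for k
  proof -
    have "1 \<le> k" using assms that by auto
    then show ?thesis
      by (auto simp: layer_def char_vec_def indicator_def sgn_if)
  qed
  then have "(\<Sum>k\<in>S. layer z k) $ i = (\<Sum>k\<in>S. sgn (z $ i) * (if k \<le> \<bar>z $ i\<bar> then 1 else 0))"
    by (simp add: sum_component)
  also have "\<dots> = sgn (z $ i) * int (card {k \<in> S. k \<le> \<bar>z $ i\<bar>})"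
    using fin by (simp add: sum_distrib_left[symmetric] sum.If_cases Int_def)
  finally show ?thesis .
qed

lemma sum_layer: "(\<Sum>k\<in>{1..linf_norm z}. layer z k) = z"
proof (rule vec_eq_iff[THEN iffD2], rule allI)
  fix i
  have "\<bar>z $ i\<bar> \<le> linf_norm z" by (simp add: linf_norm_def)
  then have "{k \<in> {1..linf_norm z}. k \<le> \<bar>z $ i\<bar>} = {1..\<bar>z $ i\<bar>}" by auto
  then show "(\<Sum>k\<in>{1..linf_norm z}. layer z k) $ i = z $ i"
    using sum_layer_nth[of "{1..linf_norm z}" "linf_norm z" z i]
    by (simp add: sgn_mult_abs)
qed

section \<open>Directed midpoints\<close>

lemma ddm_mu_nth:
  "ddm_mu u v $ i =
    (if u $ i \<ge> v $ i then (u $ i + v $ i + 1) div 2 else (u $ i + v $ i) div 2)"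
proof -
  have "\<lfloor>real_of_int k / 2\<rfloor> = k div 2" for k
    using floor_divide_of_int_eq[of k 2] by simp
  moreover have "\<lceil>real_of_int k / 2\<rceil> = (k + 1) div 2" for k
    using ceiling_divide_eq_div[of k 2, where ?'a = real] by simp
  ultimately show ?thesis
    unfolding ddm_mu_def by (simp del: of_int_add)
qed

lemma ddm_mu_add_swap: "ddm_mu u v + ddm_mu v u = u + v"
proof (rule vec_eq_iff[THEN iffD2], rule allI)
  fix i
  have "k div 2 + (k + 1) div 2 = k" for k :: int by presburger
  then show "(ddm_mu u v + ddm_mu v u) $ i = (u + v) $ i"
    by (simp add: ddm_mu_nth add.commute[of "v $ i"] add.commute[of "(_ + 1) div 2"])
qed

text \<open>
  At each coordinate \<open>i\<close> the two points differ by \<open>sgn z\<^sub>i \<cdot> c\<close>, where \<open>c\<close> counts the elements of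
  \<open>T - S\<close> up to \<open>\<bar>z\<^sub>i\<bar>\<close>.  The midpoint directed towards the point of \<open>T\<close> moves from the point of \<open>S\<close>
  by \<open>\<lceil>c / 2\<rceil>\<close> in the direction of that sign, and \<open>\<lceil>c / 2\<rceil>\<close> is the number of odd ranks up to \<open>c\<close>.  The
  other midpoint is determined by the sum of the two.
\<close>
lemma ddm_mu_sum_layer:
  fixes x z :: "int ^ 'n"
  defines "p \<equiv> \<lambda>S. x + (\<Sum>k\<in>S. layer z k)"
  assumes "S \<subseteq> T" and "T \<subseteq> {1..m}"
  shows "ddm_mu (p T) (p S) = p (S \<union> odd_rank (T - S))"
    and "ddm_mu (p S) (p T) = p (T - odd_rank (T - S))"
proof -
  define D where "D = T - S"
  have sub: "odd_rank D \<subseteq> D" by (rule odd_rank_subset)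
  have D: "D \<subseteq> {1..m}" using assms by (auto simp: D_def)
  have fin: "finite T" "finite S" "finite D" "finite (odd_rank D)"
    using assms(2,3) sub D by (meson finite_subset finite_atLeastAtMost_int order_trans)+
  have pT: "p T = p S + (\<Sum>k\<in>D. layer z k)"
    using sum.subset_diff[OF assms(2) fin(1), of "layer z"] by (simp add: p_def D_def)
  have "S \<inter> odd_rank D = {}" using sub by (auto simp: D_def)
  then have pO: "p (S \<union> odd_rank D) = p S + (\<Sum>k\<in>odd_rank D. layer z k)"
    using fin by (simp add: p_def sum.union_disjoint)
  have "odd_rank D \<subseteq> T" using sub by (auto simp: D_def)
  then have pTO: "p T = p (T - odd_rank D) + (\<Sum>k\<in>odd_rank D. layer z k)"
    using sum.subset_diff[of "odd_rank D" T "layer z"] fin by (simp add: p_def)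
  show up: "ddm_mu (p T) (p S) = p (S \<union> odd_rank (T - S))"
    unfolding D_def[symmetric] pO
  proof (rule vec_eq_iff[THEN iffD2], rule allI)
    fix i
    define c where "c = card {k \<in> D. k \<le> \<bar>z $ i\<bar>}"
    have T: "p T $ i = p S $ i + sgn (z $ i) * int c"
      using sum_layer_nth[OF D] by (simp add: pT c_def)
    have "{k \<in> odd_rank D. k \<le> \<bar>z $ i\<bar>} = odd_rank {k \<in> D. k \<le> \<bar>z $ i\<bar>}"
      by (simp add: odd_rank_initial_segment)
    then have "card {k \<in> odd_rank D. k \<le> \<bar>z $ i\<bar>} = (c + 1) div 2"
      using fin by (simp add: card_odd_rank c_def)
    then have "(p S + (\<Sum>k\<in>odd_rank D. layer z k)) $ i
        = p S $ i + sgn (z $ i) * ((int c + 1) div 2)"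
      using sum_layer_nth[OF order_trans[OF sub D], of z i] by (simp add: zdiv_int add.commute)
    moreover have "ddm_mu (p T) (p S) $ i = p S $ i + sgn (z $ i) * ((int c + 1) div 2)"
    proof -
      consider "sgn (z $ i) = 0" | "sgn (z $ i) = 1" | "sgn (z $ i) = -1"
        by (metis linorder_neqE sgn_0 sgn_neg sgn_pos)
      then show ?thesis
        by cases (simp_all add: ddm_mu_nth T, presburger+)
    qed
    ultimately show "ddm_mu (p T) (p S) $ i
        = (p S + (\<Sum>k\<in>odd_rank D. layer z k)) $ i" by simp
  qed
  have "ddm_mu (p S) (p T) = p S + p T - ddm_mu (p T) (p S)"
    using ddm_mu_add_swap[of "p S" "p T"] by (simp add: algebra_simps)
  then show "ddm_mu (p S) (p T) = p (T - odd_rank (T - S))"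
    unfolding up D_def[symmetric] using pO pTO by simp
qed

lemma DDM_convex_layers:
  fixes x z :: "int ^ 'n"
  assumes "DDM_convex f" and "S \<subseteq> T" and "T \<subseteq> {1..m}"
  shows "f (x + (\<Sum>k\<in>S \<union> odd_rank (T - S). layer z k))
       + f (x + (\<Sum>k\<in>T - odd_rank (T - S). layer z k))
       \<le> f (x + (\<Sum>k\<in>S. layer z k)) + f (x + (\<Sum>k\<in>T. layer z k))"
  using assms(1) unfolding DDM_convex_def ddm_mu_sum_layer[OF assms(2,3), symmetric]
  by (metis add.commute)

section \<open>The parallelogram inequality\<close>

theorem theorem4p6:
  fixes f :: "int ^ 'n \<Rightarrow> ereal"
    and x y d :: "int ^ 'n"
    and m :: int
    and A B :: "int \<Rightarrow> 'n set"
    and J :: "int set"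
  assumes "DDM_convex f"
    and "x \<in> eff_dom f" and "y \<in> eff_dom f"
    and "m = linf_norm (y - x)"
    and "\<And>k. k \<in> {1..m} \<Longrightarrow> A k = {i. y $ i - x $ i \<ge> k}"
    and "\<And>k. k \<in> {1..m} \<Longrightarrow> B k = {i. y $ i - x $ i \<le> - k}"
    and "J \<subseteq> {1..m}"
    and "d = (\<Sum>k\<in>J. char_vec (A k) - char_vec (B k))"
  shows "f x + f y \<ge> f (x + d) + f (y - d)"
proof -
  define F where "F S = f (x + (\<Sum>k\<in>S. layer (y - x) k))" for S
  have d: "d = (\<Sum>k\<in>J. layer (y - x) k)"
    unfolding assms(8) using assms(5-7) by (intro sum.cong) (auto simp: layer_def)
  have all: "(\<Sum>k\<in>{1..m}. layer (y - x) k) = y - x"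
    using sum_layer[of "y - x"] assms(4) by simp
  have "(\<Sum>k\<in>{1..m} - J. layer (y - x) k) = y - x - d"
    using sum.subset_diff[OF assms(7), of "layer (y - x)"]
    by (metis all d add_diff_cancel_right' finite_atLeastAtMost_int)
  then have F: "F {} = f x" "F {1..m} = f y" "F J = f (x + d)" "F ({1..m} - J) = f (y - d)"
    by (simp_all add: F_def all d)
  have "F J + F ({1..m} - J) \<le> F {} + F {1..m}"
  proof (rule parallelogram_if_halving)
    show "F S \<noteq> -\<infinity>" for S
      using assms(1) by (simp add: F_def DDM_convex_def)
    show "F {} < \<infinity>" "F {1..m} < \<infinity>"
      using assms(2,3) unfolding F by (simp_all add: eff_dom_def)
    show "F (S \<union> odd_rank (T - S)) + F (T - odd_rank (T - S)) \<le> F S + F T"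
      if "S \<subseteq> T" "T \<subseteq> {1..m}" for S T
      unfolding F_def by (rule DDM_convex_layers[OF assms(1) that])
  qed (use assms(7) in auto)
  then show ?thesis by (simp add: F)
qed

end
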